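(* Let $\mathbf{X}\in\mathbb{R}^{n\times d}$ and $\mathbf{y}\in\{-1,1\}^n$. If the complexity measure $\mu_\mathbf{y}(\mathbf{X})$ is finite, it can be computed exactly by solving a linear program with $2n$ variables and $4n$ constraints.
   Context: The classification complexity measure is $\mu_\mathbf{y}(\mathbf{X}) = \sup_{\beta \neq 0} \frac{\|(\mathbf{D}_\mathbf{y}\mathbf{X}\beta)^+\|_1}{\|(\mathbf{D}_\mathbf{y}\mathbf{X}\beta)^-\|_1}$, where $\mathbf{D}_\mathbf{y}$ is the diagonal matrix with diagonal $\mathbf{y}$, and $(\mathbf{v})^+$, $(\mathbf{v})^-$ denote the vectors of positive entries and of absolute values of negative entries of $\mathbf{v}$. *)

theory Defs
  imports "HOL-Analysis.Analysis"
begin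

definition diag :: "real^'n \<Rightarrow> real^'n^'n" where
  "diag y = (\<chi> i j. if i = j then y $ i else 0)"

definition norm1 :: "real^'n \<Rightarrow> real" where
  "norm1 v = (\<Sum>i\<in>UNIV. \<bar>v $ i\<bar>)"

(* Both vectors keep all n coordinates, with 0 in the places of the entries that are left out;
   this does not change the 1-norm. *)

definition pos_entries :: "real^'n \<Rightarrow> real^'n" where
  "pos_entries v = (\<chi> i. if v $ i > 0 then v $ i else 0)"

definition neg_entries :: "real^'n \<Rightarrow> real^'n" where
  "neg_entries v = (\<chi> i. if v $ i < 0 then \<bar>v $ i\<bar> else 0)"

(* Division is that of ennreal: a / 0 = \<infinity> for a > 0, so the measure is infinite as soon as the
   denominator vanishes while the numerator does not; 0 / 0 = 0, so a nonzero \<beta> in the kernel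
   of D_y X does not contribute to the supremum. *)

definition complexity_measure :: "real^'d^'n \<Rightarrow> real^'n \<Rightarrow> ennreal" where
  "complexity_measure X y =
     (SUP \<beta>\<in>{\<beta>. \<beta> \<noteq> 0}.
        ennreal (norm1 (pos_entries ((diag y ** X) *v \<beta>))) /
        ennreal (norm1 (neg_entries ((diag y ** X) *v \<beta>))))"

(* The linear program: maximize objective \<bullet> x subject to matrix *v x \<le> rhs (componentwise),
   with x otherwise unrestricted: sign conditions count as constraints. *)

record ('v, 'c) linear_program =
  objective :: "real^'v::finite"
  matrix :: "real^'v::finite^'c::finite"
  rhs :: "real^'c::finite"

definition num_variables :: "('v::finite, 'c::finite) linear_program \<Rightarrow> nat" where
  "num_variables P = CARD('v)"

definition num_constraints :: "('v::finite, 'c::finite) linear_program \<Rightarrow> nat" where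
  "num_constraints P = CARD('c)"

definition feasible :: "('v::finite, 'c::finite) linear_program \<Rightarrow> (real^'v) set" where
  "feasible P = {x. \<forall>r. (matrix P *v x) $ r \<le> rhs P $ r}"

definition optimal_solution :: "('v::finite, 'c::finite) linear_program \<Rightarrow> real^'v \<Rightarrow> bool" where
  "optimal_solution P x \<longleftrightarrow>
     x \<in> feasible P \<and> (\<forall>x'\<in>feasible P. objective P \<bullet> x' \<le> objective P \<bullet> x)"

(* With A = D_y X and G = A A^T, the column spaces of A and G agree, so the vectors A \<beta> are
   exactly the vectors G w with w \<in> \<real>^n. The variables are (w, v) \<in> \<real>^n \<times> \<real>^n; v stands for
   (A \<beta>)^- and G w + v for (A \<beta>)^+. The program is

     maximize  sum_i (G w + v)_i
     subject to  G w + v \<ge> 0,  v \<ge> 0,  sum_j v_j \<le> s,  sum_j v_j \<ge> s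

   where s = 1 normalizes the denominator of the ratio. Each of the last two constraints is
   repeated n times, which brings the number of rows to 4n. If X = 0, every ratio is 0 / 0 and
   the measure is 0; the choice s = 0 makes the program agree with this. *)

definition gram :: "real^'d^'n \<Rightarrow> real^'n \<Rightarrow> real^'n^'n" where
  "gram X y = (diag y ** X) ** transpose (diag y ** X)"

definition complexity_lp ::
  "real^'d^'n \<Rightarrow> real^'n \<Rightarrow> ('n + 'n, ('n + 'n) + ('n + 'n)) linear_program" where
  "complexity_lp X y = (let G = gram X y; s = (if X = 0 then 0 else 1) in
     \<lparr> objective = (\<chi> k. case k of Inl j \<Rightarrow> (\<Sum>i\<in>UNIV. G $ i $ j) | Inr j \<Rightarrow> 1),
       matrix = (\<chi> r k. case r of
           Inl (Inl i) \<Rightarrow> (case k of Inl j \<Rightarrow> - (G $ i $ j) | Inr j \<Rightarrow> - (if i = j then 1 else 0))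
         | Inl (Inr i) \<Rightarrow> (case k of Inl j \<Rightarrow> 0 | Inr j \<Rightarrow> - (if i = j then 1 else 0))
         | Inr (Inl i) \<Rightarrow> (case k of Inl j \<Rightarrow> 0 | Inr j \<Rightarrow> 1)
         | Inr (Inr i) \<Rightarrow> (case k of Inl j \<Rightarrow> 0 | Inr j \<Rightarrow> - 1)),
       rhs = (\<chi> r. case r of
           Inl _ \<Rightarrow> 0
         | Inr (Inl _) \<Rightarrow> s
         | Inr (Inr _) \<Rightarrow> - s) \<rparr>)"

end

theory Submission imports Defs begin

text \<open>
  Write \<open>P z\<close> and \<open>N z\<close> for the 1-norms of the positive and negative entries of a vector \<open>z\<close>, and
  \<open>A = D\<^sub>y X\<close>. The Gram matrix \<open>G = A A\<^sup>T\<close> has the same column space as \<open>A\<close>, so a feasible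
  point provides a vector \<open>z = G w\<close> of that space and a slack \<open>c \<ge> 0\<close> with
  \<open>N z + c = 1\<close> and objective value \<open>P z + c\<close>. Finiteness of the measure \<open>\<mu>\<close> means that \<open>P\<close> and \<open>N\<close>
  are positive on the nonzero vectors of the column space, so \<open>P / N\<close> attains its supremum \<open>\<mu>\<close> on
  the unit sphere of that space. As \<open>P (-z) / N (-z)\<close> is the reciprocal of \<open>P z / N z\<close>, one
  has \<open>\<mu> \<ge> 1\<close>, hence \<open>P z + c \<le> \<mu> N z + \<mu> c = \<mu>\<close>: the slack never pays.
\<close>

section \<open>Linear algebra: positive and negative entries, Gram matrices\<close>

lemma norm1_pos_entries: "norm1 (pos_entries z) = (\<Sum>i\<in>UNIV. max 0 (z $ i))"
  unfolding norm1_def pos_entries_def by (intro sum.cong) auto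

lemma norm1_neg_entries: "norm1 (neg_entries z) = (\<Sum>i\<in>UNIV. max 0 (- (z $ i)))"
  unfolding norm1_def neg_entries_def by (intro sum.cong) auto

lemma norm1_pos_entries_minus: "norm1 (pos_entries (- z)) = norm1 (neg_entries z)"
  by (simp add: norm1_pos_entries norm1_neg_entries)

lemma norm1_neg_entries_minus: "norm1 (neg_entries (- z)) = norm1 (pos_entries z)"
  by (simp add: norm1_pos_entries norm1_neg_entries)

lemma norm1_nonneg: "0 \<le> norm1 v"
  by (simp add: norm1_def sum_nonneg)

lemma norm1_pos_entries_scaleR:
  assumes "0 \<le> c"
  shows "norm1 (pos_entries (c *\<^sub>R z)) = c * norm1 (pos_entries z)"
  unfolding norm1_pos_entries sum_distrib_left
  using assms by (intro sum.cong) (auto simp: max_mult_distrib_left)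

lemma norm1_neg_entries_scaleR:
  assumes "0 \<le> c"
  shows "norm1 (neg_entries (c *\<^sub>R z)) = c * norm1 (neg_entries z)"
  using norm1_pos_entries_scaleR[OF assms, of "- z"] by (simp flip: norm1_pos_entries_minus)

lemma norm1_pos_neg_entries_eq_0:
  assumes "norm1 (pos_entries z) = 0" "norm1 (neg_entries z) = 0"
  shows "z = 0"
proof -
  have "max 0 (z $ i) = 0 \<and> max 0 (- (z $ i)) = 0" for i
    using assms unfolding norm1_pos_entries norm1_neg_entries
    by (simp add: sum_nonneg_eq_0_iff)
  then show ?thesis
    by (simp add: vec_eq_iff max_def) (smt (verit))
qed

text \<open>This links the linear objective, a plain sum of coordinates, to the two norms in the
  ratio.\<close>

lemma sum_nth_eq_norm1_diff:
  "(\<Sum>i\<in>UNIV. z $ i) = norm1 (pos_entries z) - norm1 (neg_entries z)"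
  unfolding norm1_pos_entries norm1_neg_entries sum_subtractf[symmetric]
  by (intro sum.cong) auto

text \<open>Only the component of \<open>b\<close> in the range of the transpose contributes to
  \<open>A *v b\<close>: the part \<open>q\<close> orthogonal to that range is killed by
  \<open>A\<close>.\<close>

lemma range_matrix_gram:
  fixes A :: "real^'d^'n"
  shows "range ((*v) (A ** transpose A)) = range ((*v) A)"
proof (intro equalityI subsetI)
  fix z assume "z \<in> range ((*v) (A ** transpose A))"
  then show "z \<in> range ((*v) A)"
    by (auto simp flip: matrix_vector_mul_assoc)
next
  fix z assume "z \<in> range ((*v) A)"
  then obtain b where z: "z = A *v b" by auto
  obtain p q where p: "p \<in> span (range ((*v) (transpose A)))"
    and q: "\<And>w. w \<in> span (range ((*v) (transpose A))) \<Longrightarrow> orthogonal q w"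
    and b: "b = p + q"
    using orthogonal_subspace_decomp_exists by blast
  have "span (range ((*v) (transpose A))) = range ((*v) (transpose A))"
    by (intro iffD2[OF span_eq_iff] linear_subspace_image matrix_vector_mul_linear subspace_UNIV)
  with p obtain w where w: "p = transpose A *v w" by blast
  \<comment> \<open>Moving the transpose across the inner product turns this into
    \<open>A *v q\<close> being orthogonal to itself.\<close>
  have "orthogonal q (transpose A *v (A *v q))"
    by (rule q) (simp add: span_base)
  then have "A *v q = 0"
    by (simp add: orthogonal_def dot_lmul_matrix inner_commute flip: transpose_matrix_vector)
       (metis dot_lmul_matrix inner_commute inner_eq_zero_iff transpose_matrix_vector transpose_transpose)
  then have "z = (A ** transpose A) *v w"
    unfolding z b w matrix_vector_right_distrib matrix_vector_mul_assoc by simp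
  then show "z \<in> range ((*v) (A ** transpose A))" by blast
qed

lemma diag_mult_nth: "(diag y ** X) $ i $ j = y $ i * X $ i $ j"
  by (simp add: diag_def matrix_matrix_mult_def if_distrib[where f = "\<lambda>a. a * _"] cong: if_cong)

section \<open>The linear program in block form, with variable blocks w and v\<close>

lemma sum_UNIV_Plus:
  "(\<Sum>k\<in>UNIV. f k) = (\<Sum>i\<in>UNIV. f (Inl i)) + (\<Sum>j\<in>UNIV. f (Inr j))"
  for f :: "'a::finite + 'b::finite \<Rightarrow> 'c::comm_monoid_add"
  by (simp add: sum.Plus flip: UNIV_Plus_UNIV)

definition left_part :: "real^('n::finite + 'm::finite) \<Rightarrow> real^'n" where
  "left_part x = (\<chi> i. x $ Inl i)"

definition right_part :: "real^('n::finite + 'm::finite) \<Rightarrow> real^'m" where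
  "right_part x = (\<chi> i. x $ Inr i)"

definition join_parts :: "real^'n::finite \<Rightarrow> real^'m::finite \<Rightarrow> real^('n + 'm)" where
  "join_parts w v = (\<chi> k. case k of Inl i \<Rightarrow> w $ i | Inr j \<Rightarrow> v $ j)"

lemma parts_join_parts [simp]:
  "left_part (join_parts w v) = w" "right_part (join_parts w v) = v"
  by (simp_all add: left_part_def right_part_def join_parts_def vec_eq_iff)

lemma objective_complexity_lp:
  fixes X :: "real^'d^'n"
  shows "objective (complexity_lp X y) \<bullet> x =
    (\<Sum>i\<in>UNIV. (gram X y *v left_part x + right_part x) $ i)"
proof -
  have "(\<Sum>j\<in>UNIV. (\<Sum>i\<in>UNIV. gram X y $ i $ j) * x $ Inl j) =
      (\<Sum>i\<in>UNIV. \<Sum>j\<in>UNIV. gram X y $ i $ j * x $ Inl j)"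
    by (subst sum.swap) (simp add: sum_distrib_right)
  then show ?thesis
    by (simp add: complexity_lp_def Let_def inner_vec_def sum_UNIV_Plus matrix_vector_mult_def
        left_part_def right_part_def sum.distrib)
qed

text \<open>The last two blocks each repeat one inequality in every row; the two inequalities are
  opposite, so together they say that the sum of v equals the right-hand side.\<close>

lemma feasible_complexity_lp:
  fixes X :: "real^'d^'n"
  shows "x \<in> feasible (complexity_lp X y) \<longleftrightarrow>
    (\<forall>i. 0 \<le> (gram X y *v left_part x + right_part x) $ i) \<and>
    (\<forall>i. 0 \<le> right_part x $ i) \<and>
    (\<Sum>i\<in>UNIV. right_part x $ i) = (if X = 0 then 0 else 1)"
proof -
  have delta: "(\<Sum>j\<in>UNIV. (if i = j then 1 else 0) * x $ Inr j) = x $ Inr i" for i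
    by (simp add: if_distrib[where f = "\<lambda>a. a * _"] cong: if_cong)
  have split: "(\<forall>r. Q r) \<longleftrightarrow>
      (\<forall>i. Q (Inl (Inl i))) \<and> (\<forall>i. Q (Inl (Inr i))) \<and>
      (\<forall>i. Q (Inr (Inl i))) \<and> (\<forall>i. Q (Inr (Inr i)))"
    for Q :: "('n + 'n) + ('n + 'n) \<Rightarrow> bool"
    by (metis sum.exhaust)
  have neg: "- a \<le> b \<longleftrightarrow> 0 \<le> a + b" for a b :: real
    by linarith
  show ?thesis
    unfolding feasible_def mem_Collect_eq split
    by (simp add: complexity_lp_def Let_def matrix_vector_mult_def sum_UNIV_Plus
        left_part_def right_part_def sum_negf delta neg) auto
qed

section \<open>The optimal value and the complexity measure\<close>

theorem theorem3:
  fixes X :: "real^'d^'n" and y :: "real^'n"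
  assumes "\<forall>i. y $ i \<in> {-1, 1}"
    and "complexity_measure X y < \<infinity>"
  shows "num_variables (complexity_lp X y) = 2 * CARD('n)
    \<and> num_constraints (complexity_lp X y) = 4 * CARD('n)
    \<and> (\<exists>x. optimal_solution (complexity_lp X y) x)
    \<and> (\<forall>x. optimal_solution (complexity_lp X y) x \<longrightarrow>
          objective (complexity_lp X y) \<bullet> x = enn2real (complexity_measure X y))"
proof -
  define A where "A = diag y ** X"
  define G where "G = gram X y"
  define P where "P z = norm1 (pos_entries z)" for z :: "real^'n"
  define N where "N z = norm1 (neg_entries z)" for z :: "real^'n"
  let ?m = "complexity_measure X y"
  let ?L = "complexity_lp X y"
  have range_G: "range ((*v) G) = range ((*v) A)"
    unfolding G_def gram_def A_def by (rule range_matrix_gram)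
  have P_nonneg: "0 \<le> P z" and N_nonneg: "0 \<le> N z" for z
    by (simp_all add: P_def N_def norm1_nonneg)
  have m_eq: "?m = (SUP b\<in>{b. b \<noteq> 0}. ennreal (P (A *v b)) / ennreal (N (A *v b)))"
    by (simp add: complexity_measure_def A_def P_def N_def)
  have ratio_le: "ennreal (P (A *v b)) / ennreal (N (A *v b)) \<le> ?m" if "b \<noteq> 0" for b
    unfolding m_eq using that by (intro SUP_upper) auto
  \<comment> \<open>Finiteness enters here: a zero denominator under a positive numerator would be
    an infinite ratio.\<close>
  have N_pos: "0 < N z" if range: "z \<in> range ((*v) A)" and "z \<noteq> 0" for z
  proof (rule ccontr)
    assume "\<not> 0 < N z"
    then have N0: "N z = 0" using N_nonneg[of z] by simp
    with \<open>z \<noteq> 0\<close> have "0 < P z"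
      using norm1_pos_neg_entries_eq_0[of z] P_nonneg[of z]
      unfolding P_def N_def by linarith
    moreover obtain b where b: "z = A *v b" using range by blast
    moreover have "b \<noteq> 0" using b \<open>z \<noteq> 0\<close> by auto
    ultimately show False
      using ratio_le[of b] assms(2) N0 by (simp add: ennreal_divide_zero)
  qed
  \<comment> \<open>A value that is an upper bound and is attained is the value of every optimal
    solution, so these two facts suffice.\<close>
  have "(\<exists>x\<in>feasible ?L. objective ?L \<bullet> x = enn2real ?m) \<and>
      (\<forall>x\<in>feasible ?L. objective ?L \<bullet> x \<le> enn2real ?m)"
  proof (cases "X = 0")
    case True
    then have "A = 0" by (simp add: A_def vec_eq_iff diag_mult_nth)
    then have "?m \<le> 0"
      unfolding m_eq by (intro SUP_least) (simp add: P_def norm1_pos_entries)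
    then have "?m = 0" by simp
    moreover have "gram X y = 0"
      using \<open>A = 0\<close> unfolding gram_def A_def by simp
    then have "objective ?L \<bullet> x = 0" if "x \<in> feasible ?L" for x
      using that True unfolding objective_complexity_lp feasible_complexity_lp
      by (simp add: \<open>gram X y = 0\<close>)
    moreover have "join_parts 0 0 \<in> feasible ?L"
      using True by (simp add: feasible_complexity_lp)
    ultimately show ?thesis by auto
  next
    case False
    \<comment> \<open>The ratio is invariant under positive scaling, so its supremum can be sought
      on this compact set.\<close>
    define K where "K = range ((*v) A) \<inter> sphere 0 1"
    have "A \<noteq> 0"
    proof
      assume "A = 0"
      then have "y $ i * X $ i $ j = 0" for i j
        by (simp add: A_def flip: diag_mult_nth)
      moreover have "y $ i \<noteq> 0" for i
        using assms(1) by (metis insertE singletonD zero_neq_neg_one zero_neq_one)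
      ultimately show False using False by (simp add: vec_eq_iff)
    qed
    then obtain b1 where b1: "A *v b1 \<noteq> 0"
      by (metis matrix_eq matrix_vector_mult_0)
    have scale: "c *\<^sub>R (A *v b) \<in> range ((*v) A)" for c b
      by (metis matrix_vector_mult_scaleR rangeI)
    have normalize: "(1 / norm (A *v b)) *\<^sub>R (A *v b) \<in> K" if "A *v b \<noteq> 0" for b
      using that scale unfolding K_def by simp
    have "subspace (range ((*v) A))"
      by (simp add: subspace_UNIV linear_subspace_image)
    then have "compact K"
      unfolding K_def by (intro closed_Int_compact closed_subspace) auto
    moreover have "K \<noteq> {}" using normalize[OF b1] by blast
    moreover have "continuous_on K (\<lambda>z. P z / N z)"
    proof (intro continuous_on_divide ballI)
      show "continuous_on K P" "continuous_on K N"
        unfolding P_def N_def norm1_pos_entries norm1_neg_entries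
        by (intro continuous_intros)+
      fix z assume "z \<in> K"
      then have "z \<in> range ((*v) A)" "z \<noteq> 0" unfolding K_def by auto
      then show "N z \<noteq> 0" by (metis N_pos less_irrefl)
    qed
    ultimately have "\<exists>z0\<in>K. \<forall>z\<in>K. P z / N z \<le> P z0 / N z0"
      by (rule continuous_attains_sup)
    then obtain z0 where z0: "z0 \<in> K"
      and max: "\<And>z. z \<in> K \<Longrightarrow> P z / N z \<le> P z0 / N z0"
      by blast
    define r where "r = P z0 / N z0"
    have r_nonneg: "0 \<le> r" by (simp add: r_def P_nonneg N_nonneg)
    \<comment> \<open>Cleared of denominators, the maximality of \<open>r\<close> also covers
      \<open>z = 0\<close>.\<close>
    have P_le: "P z \<le> r * N z" if range: "z \<in> range ((*v) A)" for z
    proof (cases "z = 0")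
      case True
      then show ?thesis by (simp add: P_def N_def norm1_pos_entries norm1_neg_entries)
    next
      case False
      obtain b where z: "z = A *v b" using range by blast
      have "P z / N z = P ((1 / norm z) *\<^sub>R z) / N ((1 / norm z) *\<^sub>R z)"
        using False by (simp add: P_def N_def norm1_pos_entries_scaleR norm1_neg_entries_scaleR)
      also have "\<dots> \<le> r"
        unfolding r_def using max normalize[of b] False z by simp
      finally show ?thesis using N_pos[OF range False] by (simp add: divide_le_eq)
    qed
    have z0_range: "z0 \<in> range ((*v) A)" and "z0 \<noteq> 0" using z0 by (auto simp: K_def)
    then have N0: "0 < N z0" by (rule N_pos)
    have "?m = ennreal r"
    proof (rule antisym)
      show "?m \<le> ennreal r"
        unfolding m_eq
      proof (intro SUP_least)
        fix b :: "real^'d"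
        show "ennreal (P (A *v b)) / ennreal (N (A *v b)) \<le> ennreal r"
        \<comment> \<open>A vector in the kernel gives 0 / 0, which is 0 in
          \<open>ennreal\<close>.\<close>
        proof (cases "A *v b = 0")
          case True
          then show ?thesis by (simp add: P_def norm1_pos_entries)
        next
          case False
          then have "0 < N (A *v b)" by (intro N_pos) auto
          then show ?thesis
            using P_le[of "A *v b"] by (simp add: divide_ennreal P_nonneg ennreal_leI divide_le_eq)
        qed
      qed
      obtain b0 where "z0 = A *v b0" using z0_range by blast
      moreover from this have "b0 \<noteq> 0" using \<open>z0 \<noteq> 0\<close> by auto
      ultimately show "ennreal r \<le> ?m"
        using ratio_le[of b0] N0 by (simp add: r_def divide_ennreal P_nonneg)
    qed
    then have m: "enn2real ?m = r" using r_nonneg by simp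
    \<comment> \<open>Applying \<open>P_le\<close> to both \<open>- z0\<close> and \<open>z0\<close>
      gives \<open>N z0\<close> \<le> \<open>r * P z0\<close> \<le>
      \<open>r * r * N z0\<close>.\<close>
    have "1 \<le> r"
    proof -
      have "- z0 \<in> range ((*v) A)"
        using z0_range \<open>subspace (range ((*v) A))\<close> by (rule subspace_neg[rotated])
      then have "N z0 \<le> r * P z0"
        using P_le[of "- z0"]
        by (simp add: P_def N_def norm1_pos_entries_minus norm1_neg_entries_minus)
      also have "\<dots> \<le> r * (r * N z0)"
        using P_le[OF z0_range] r_nonneg by (rule mult_left_mono)
      finally have "1 * N z0 \<le> (r * r) * N z0" by simp
      with N0 have "1 * 1 \<le> r * r" by (simp only: mult_le_cancel_right) simp
      then show ?thesis using r_nonneg by (metis abs_of_nonneg abs_1 abs_le_square_iff power2_eq_square)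
    qed
    have "objective ?L \<bullet> x \<le> r" if "x \<in> feasible ?L" for x
    proof -
      define z where "z = G *v left_part x"
      define v where "v = right_part x"
      have pos: "\<And>i. 0 \<le> z $ i + v $ i" "\<And>i. 0 \<le> v $ i" and v: "(\<Sum>i\<in>UNIV. v $ i) = 1"
        using that False by (simp_all add: feasible_complexity_lp z_def v_def G_def)
      \<comment> \<open>Feasibility makes each coordinate of \<open>v\<close> at least
        \<open>max 0 (- (z $ i))\<close>. With \<open>P_le\<close>, the objective
        \<open>P z - N z + 1\<close> is then at most \<open>(r - 1) * N z + 1\<close>, hence at most
        \<open>r\<close>.\<close>
      have "N z \<le> (\<Sum>i\<in>UNIV. v $ i)"
        unfolding N_def norm1_neg_entries using pos by (intro sum_mono) (smt (verit))
      then have "(r - 1) * N z \<le> (r - 1) * 1"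
        using \<open>1 \<le> r\<close> v by (intro mult_left_mono) auto
      moreover have "P z \<le> r * N z"
        by (rule P_le) (simp add: z_def flip: range_G)
      moreover have "objective ?L \<bullet> x = P z - N z + 1"
        using v by (simp add: objective_complexity_lp sum.distrib sum_nth_eq_norm1_diff
            P_def N_def z_def v_def G_def)
      ultimately show ?thesis by (simp add: left_diff_distrib)
    qed
    moreover have "\<exists>x\<in>feasible ?L. objective ?L \<bullet> x = r"
    proof -
      \<comment> \<open>The maximizer is rescaled to denominator 1; taking
        \<open>v = neg_entries z\<close> leaves no slack, so the objective is exactly
        \<open>P z = r\<close>.\<close>
      define z where "z = (1 / N z0) *\<^sub>R z0"
      have "N z = 1" "P z = r"
        using N0 by (simp_all add: z_def N_def P_def r_def
            norm1_pos_entries_scaleR norm1_neg_entries_scaleR)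
      have "z \<in> range ((*v) G)"
        unfolding range_G z_def
        using z0_range \<open>subspace (range ((*v) A))\<close> by (intro subspace_scale)
      then obtain w where w: "z = G *v w" by blast
      define x where "x = join_parts w (neg_entries z)"
      have x: "gram X y *v left_part x = z" "right_part x = neg_entries z"
        by (simp_all add: x_def w G_def)
      have sum: "(\<Sum>i\<in>UNIV. neg_entries z $ i) = 1"
        using \<open>N z = 1\<close> by (simp add: N_def norm1_def neg_entries_def cong: if_cong)
      have "x \<in> feasible ?L"
        using False sum by (simp add: feasible_complexity_lp x) (simp add: neg_entries_def)
      moreover have "objective ?L \<bullet> x = r"
        using sum \<open>N z = 1\<close> \<open>P z = r\<close>
        by (simp add: objective_complexity_lp x sum.distrib sum_nth_eq_norm1_diff P_def N_def)
      ultimately show ?thesis by blast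
    qed
    ultimately show ?thesis by (simp add: m)
  qed
  then have attained: "\<exists>x\<in>feasible ?L. objective ?L \<bullet> x = enn2real ?m"
    and bound: "\<forall>x\<in>feasible ?L. objective ?L \<bullet> x \<le> enn2real ?m"
    by blast+
  have "num_variables ?L = 2 * CARD('n)" "num_constraints ?L = 4 * CARD('n)"
    by (simp_all add: num_variables_def num_constraints_def)
  moreover obtain x where "x \<in> feasible ?L" "objective ?L \<bullet> x = enn2real ?m"
    using attained by blast
  moreover from this have "optimal_solution ?L x"
    using bound by (simp add: optimal_solution_def)
  moreover have "objective ?L \<bullet> x' = enn2real ?m" if "optimal_solution ?L x'" for x'
    using that attained bound by (fastforce simp: optimal_solution_def)
  ultimately show ?thesis by blast
qed

end
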